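(* Let $\lambda>0$, let $A$ be a linear map from $X=\mathbb{R}^{m\times n}$ to a Euclidean space, let $f$ be a vector in that space, and assume (A1) $\mathcal{N}(\nabla)\cap\mathcal{N}(A)=\{0\}$, where $\mathcal N$ denotes the null space. Let $M\ge 0$ and $\epsilon>0$ be constants. Then there is $\bar\rho>0$, depending only on $\lambda,A,m,n,M,\epsilon$, such that for every $\rho_2\ge\bar\rho$ the following holds. Let $\{(u^{(k)},\mathbf h^{(k)},\mathbf b_2^{(k)})\}_{k\ge 0}$ be generated by the ADMM scheme $$u^{(k+1)}=\arg\min_u \mathcal L_{\mathrm{uncon}}(u,\mathbf h^{(k)};\mathbf b_2^{(k)}),\quad \mathbf h^{(k+1)}\in\arg\min_{\mathbf h}\mathcal L_{\mathrm{uncon}}(u^{(k+1)},\mathbf h;\mathbf b_2^{(k)}),\quad \mathbf b_2^{(k+1)}=\mathbf b_2^{(k)}+\nabla u^{(k+1)}-\mathbf h^{(k+1)},$$ and suppose that (A2) $\{u^{(k)}\}$ is bounded, with $M=\sup_k\|\nabla u^{(k)}\|_1$; (A3) $\|\mathbf h^{(k)}\|_2\ge\epsilon$ for all $k$. Then $\{(u^{(k)},\mathbf h^{(k)})\}$ has a subsequence that converges to a critical point of the problem $$\min_{u,\mathbf h}\ \frac{\|\nabla u\|_1}{\|\mathbf h\|_2}+\frac{\lambda}{2}\|Au-f\|_2^2\quad\text{s.t.}\quad \mathbf h=\nabla u .$$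
   Context: $X=\mathbb{R}^{m\times n}$ and $Y=X\times X$, with inner products $\langle x,y\rangle_X=\sum_{i,j}x_{ij}y_{ij}$ and $\langle\mathbf p,\mathbf q\rangle_Y=\sum_{i,j}\sum_{l=1}^2 p_{ij,l}q_{ij,l}$; $\|\cdot\|_2$ denotes the induced Euclidean norms (on $X$, on $Y$ and on the data space). The discrete gradient is the linear map $\nabla:X\to Y$, $\nabla u=(\nabla_x u,\nabla_y u)$, where $\nabla_x,\nabla_y$ are forward differences in the two grid directions (with a fixed standard boundary convention, e.g. periodic, or zero difference at the boundary). $\|\nabla u\|_1=\|\nabla_x u\|_1+\|\nabla_y u\|_1$ is the anisotropic total variation (sum of absolute values of all entries). The augmented Lagrangian, for $u\in X$, $\mathbf h\in Y\setminus\{0\}$, $\mathbf b_2\in Y$ and a parameter $\rho_2>0$, is $$\mathcal L_{\mathrm{uncon}}(u,\mathbf h;\mathbf b_2)=\frac{\|\nabla u\|_1}{\|\mathbf h\|_2}+\frac{\lambda}{2}\|Au-f\|_2^2+\rho_2\langle\mathbf b_2,\nabla u-\mathbf h\rangle_Y+\frac{\rho_2}{2}\|\mathbf h-\nabla u\|_2^2 .$$ The iteration starts from arbitrary initial values. A critical point of the constrained problem is a pair $(u^*,\mathbf h^* )$ with $\mathbf h^*\neq 0$ for which there is $\mathbf b_2^*\in Y$ with $0\in\partial\mathcal L_{\mathrm{uncon}}(u^*,\mathbf h^*;\mathbf b_2^* )$, where $\partial$ is the (limiting) subdifferential in all three variables (in particular $\mathbf h^*=\nabla u^*$). *)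

theory Defs
  imports "HOL-Analysis.Analysis"
begin

text \<open>
  The image space \<open>X\<close> is \<open>real^'n^'m\<close>, abbreviated \<open>('m, 'n) img\<close> (entry \<open>u $ i $ j\<close> with row
  index \<open>i\<close> and column index \<open>j\<close>), and \<open>Y = X \<times> X\<close> is abbreviated \<open>('m, 'n) field2\<close>. The
  library's inner products and norms on these types are the entrywise Euclidean ones. The index
  types are finite linear orders; the order says which grid points are neighbours.
\<close>

type_synonym ('m, 'n) img = "((real, 'n) vec, 'm) vec"
type_synonym ('m, 'n) field2 = "('m, 'n) img \<times> ('m, 'n) img"

datatype boundary = Periodic | Zero_difference

text \<open>
  Position of the forward neighbour. At the last index, repeating that index makes the
  forward difference there equal to zero.
\<close>

definition next_index :: "boundary \<Rightarrow> 'i::{finite,linorder} \<Rightarrow> 'i" where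
  "next_index bc i =
     (if {i<..} = {} then (case bc of Periodic \<Rightarrow> Min UNIV | Zero_difference \<Rightarrow> i)
      else Min {i<..})"

definition grad_x ::
    "boundary \<Rightarrow> ('m::{finite,linorder}, 'n::{finite,linorder}) img \<Rightarrow> ('m, 'n) img" where
  "grad_x bc u = (\<chi> i j. u $ next_index bc i $ j - u $ i $ j)"

definition grad_y ::
    "boundary \<Rightarrow> ('m::{finite,linorder}, 'n::{finite,linorder}) img \<Rightarrow> ('m, 'n) img" where
  "grad_y bc u = (\<chi> i j. u $ i $ next_index bc j - u $ i $ j)"

definition grad ::
    "boundary \<Rightarrow> ('m::{finite,linorder}, 'n::{finite,linorder}) img
      \<Rightarrow> ('m, 'n) field2" where
  "grad bc u = (grad_x bc u, grad_y bc u)"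

definition l1_norm :: "('m::{finite,linorder}, 'n::{finite,linorder}) field2 \<Rightarrow> real" where
  "l1_norm p = (\<Sum>i\<in>UNIV. \<Sum>j\<in>UNIV. \<bar>fst p $ i $ j\<bar>) + (\<Sum>i\<in>UNIV. \<Sum>j\<in>UNIV. \<bar>snd p $ i $ j\<bar>)"

text \<open>
  The formula is meaningful only for \<open>h \<noteq> 0\<close>. At \<open>h = 0\<close> HOL's convention \<open>x / 0 = 0\<close> gives an
  artificial value, which the minimisation over \<open>h\<close> and the subdifferential below exclude.
\<close>

definition L_uncon ::
    "boundary \<Rightarrow> real \<Rightarrow> (('m::{finite,linorder}, 'n::{finite,linorder}) img \<Rightarrow> 'd::euclidean_space)
      \<Rightarrow> 'd \<Rightarrow> real \<Rightarrow> ('m, 'n) img \<Rightarrow> ('m, 'n) field2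
      \<Rightarrow> ('m, 'n) field2 \<Rightarrow> real" where
  "L_uncon bc lam A f \<rho> u h b =
     l1_norm (grad bc u) / norm h + lam / 2 * (norm (A u - f))\<^sup>2
     + \<rho> * (b \<bullet> (grad bc u - h)) + \<rho> / 2 * (norm (h - grad bc u))\<^sup>2"

definition L_uncon_ext ::
    "boundary \<Rightarrow> real \<Rightarrow> (('m::{finite,linorder}, 'n::{finite,linorder}) img \<Rightarrow> 'd::euclidean_space)
      \<Rightarrow> 'd \<Rightarrow> real
      \<Rightarrow> ('m, 'n) img \<times> ('m, 'n) field2 \<times> ('m, 'n) field2
      \<Rightarrow> ereal" where
  "L_uncon_ext bc lam A f \<rho> =
     (\<lambda>(u, h, b). if h = 0 then \<infinity> else ereal (L_uncon bc lam A f \<rho> u h b))"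

text \<open>
  The limiting subdifferential is that of Mordukhovich: limits of Frechet (regular) subgradients
  along sequences on which the points and the function values converge.
\<close>

definition frechet_subdifferential :: "('a::euclidean_space \<Rightarrow> ereal) \<Rightarrow> 'a \<Rightarrow> 'a set" where
  "frechet_subdifferential F x =
     {v. \<bar>F x\<bar> \<noteq> \<infinity> \<and>
         0 \<le> Liminf (at x) (\<lambda>y. (F y - F x - ereal (v \<bullet> (y - x))) / ereal (norm (y - x)))}"

definition limiting_subdifferential :: "('a::euclidean_space \<Rightarrow> ereal) \<Rightarrow> 'a \<Rightarrow> 'a set" where
  "limiting_subdifferential F x =
     {v. \<bar>F x\<bar> \<noteq> \<infinity> \<and>
         (\<exists>xs vs. xs \<longlonglongrightarrow> x \<and> (\<lambda>k. F (xs k)) \<longlonglongrightarrow> F x \<and>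
                  (\<forall>k. vs k \<in> frechet_subdifferential F (xs k)) \<and> vs \<longlonglongrightarrow> v)}"

definition critical_point ::
    "boundary \<Rightarrow> real \<Rightarrow> (('m::{finite,linorder}, 'n::{finite,linorder}) img \<Rightarrow> 'd::euclidean_space)
      \<Rightarrow> 'd \<Rightarrow> real \<Rightarrow> ('m, 'n) img \<Rightarrow> ('m, 'n) field2 \<Rightarrow> bool" where
  "critical_point bc lam A f \<rho> u h \<longleftrightarrow>
     h \<noteq> 0 \<and> (\<exists>b. 0 \<in> limiting_subdifferential (L_uncon_ext bc lam A f \<rho>) (u, h, b))"

text \<open>
  The \<open>u\<close>-subproblem is stated as membership in the set of minimisers; uniqueness of the
  minimiser is not part of this definition.
\<close>

definition admm_sequence ::
    "boundary \<Rightarrow> real \<Rightarrow> (('m::{finite,linorder}, 'n::{finite,linorder}) img \<Rightarrow> 'd::euclidean_space)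
      \<Rightarrow> 'd \<Rightarrow> real \<Rightarrow> (nat \<Rightarrow> ('m, 'n) img) \<Rightarrow> (nat \<Rightarrow> ('m, 'n) field2)
      \<Rightarrow> (nat \<Rightarrow> ('m, 'n) field2) \<Rightarrow> bool" where
  "admm_sequence bc lam A f \<rho> u h b \<longleftrightarrow>
     (\<forall>k. is_arg_min (\<lambda>v. L_uncon bc lam A f \<rho> v (h k) (b k)) (\<lambda>v. True) (u (Suc k)) \<and>
          is_arg_min (\<lambda>g. L_uncon bc lam A f \<rho> (u (Suc k)) g (b k)) (\<lambda>g. g \<noteq> 0) (h (Suc k)) \<and>
          b (Suc k) = b k + grad bc (u (Suc k)) - h (Suc k))"

end

theory Submission
  imports Defs
begin

text \<open>
  Once \<open>\<rho>\<close> is large, each sweep of the iteration lowers the augmented Lagrangian by at least a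
  fixed multiple of the squared increments of \<open>\<nabla>u\<close> and \<open>h\<close>, so these increments tend to zero and
  every limit of iterates satisfies the optimality conditions.

  The \<open>u\<close>-subproblem is convex, with curvature \<open>\<rho>\<close> along \<open>\<nabla>\<close>, so the \<open>u\<close>-step gains a multiple of
  \<open>\<rho> \<parallel>\<nabla>u' - \<nabla>u\<parallel>\<^sup>2\<close> (\<open>u_step_descent\<close>). The function \<open>1 / \<parallel>h\<parallel>\<close> is not convex, but it lies above its
  tangent at \<open>h\<close> minus the quadratic \<open>\<parallel>g - h\<parallel>\<^sup>2 / (2 \<parallel>h\<parallel>\<^sup>3)\<close> (\<open>inverse_norm_lower_bound\<close>); the penalty
  outweighs this defect, and the \<open>h\<close>-step gains a multiple of \<open>\<rho> \<parallel>h' - h\<parallel>\<^sup>2\<close> (\<open>h_step_descent\<close>). The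
  multiplier step raises the Lagrangian by \<open>\<rho> \<parallel>b' - b\<parallel>\<^sup>2\<close>. Stationarity of the \<open>h\<close>-step expresses the
  new multiplier as \<open>\<rho> b = - \<parallel>\<nabla>u\<parallel>\<^sub>1 h / \<parallel>h\<parallel>\<^sup>3\<close> (\<open>h_step_stationary\<close>), a Lipschitz function of
  \<open>(\<nabla>u, h)\<close> on the region \<open>\<parallel>\<nabla>u\<parallel>\<^sub>1 \<le> M\<close>, \<open>\<parallel>h\<parallel> \<ge> \<epsilon>\<close> with a constant independent of \<open>\<rho>\<close>. The increase
  is therefore of order \<open>1 / \<rho>\<close> times the squared increments and is absorbed by the two gains
  (\<open>lagrangian_decrease\<close>). The multipliers are bounded, so the Lagrangian is bounded below, and the
  increments vanish (\<open>admm_increments_vanish\<close>).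

  A bounded sequence has a convergent subsequence, and in the limit \<open>h = \<nabla>u\<close>, \<open>u\<close> minimises the
  Lagrangian in its first argument, and the multiplier formula persists (\<open>admm_limit_critical\<close>). No
  subdifferential calculus is needed to conclude: these three facts and the tangent inequality for
  \<open>1 / \<parallel>h\<parallel>\<close> bound the Lagrangian near the limit point from below by its value there minus a multiple
  of the squared distance, so that zero is already a Frechet subgradient (\<open>critical_pointI\<close>).
\<close>

section \<open>The discrete gradient and the anisotropic norm\<close>

lemma linear_grad: "linear (grad bc)"
  by (rule linearI)
    (simp_all add: grad_def grad_x_def grad_y_def vec_eq_iff algebra_simps)

lemma bounded_linear_grad: "bounded_linear (grad bc)"
  by (rule linear_conv_bounded_linear[THEN iffD1, OF linear_grad])

lemma l1_norm_nonneg: "0 \<le> l1_norm p"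
  unfolding l1_norm_def by (intro add_nonneg_nonneg sum_nonneg) auto

lemma l1_norm_triangle: "l1_norm (p + q) \<le> l1_norm p + l1_norm q"
proof -
  have "l1_norm (p + q) \<le>
      (\<Sum>i\<in>UNIV. \<Sum>j\<in>UNIV. \<bar>fst p $ i $ j\<bar> + \<bar>fst q $ i $ j\<bar>) +
      (\<Sum>i\<in>UNIV. \<Sum>j\<in>UNIV. \<bar>snd p $ i $ j\<bar> + \<bar>snd q $ i $ j\<bar>)"
    unfolding l1_norm_def by (intro add_mono sum_mono) (auto intro: abs_triangle_ineq)
  then show ?thesis
    by (simp add: l1_norm_def sum.distrib)
qed

lemma l1_norm_scaleR: "l1_norm (c *\<^sub>R p) = \<bar>c\<bar> * l1_norm p"
  by (simp add: l1_norm_def abs_mult sum_distrib_left distrib_left)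

lemma l1_norm_le_norm:
  fixes p :: "('m::{finite,linorder}, 'n::{finite,linorder}) field2"
  shows "l1_norm p \<le> 2 * real CARD('m) * real CARD('n) * norm p"
proof -
  have entry: "\<bar>q $ i $ j\<bar> \<le> norm q" for q :: "('m, 'n) img" and i j
    using component_le_norm_cart[of "q $ i" j] Finite_Cartesian_Product.norm_nth_le[of q i] by linarith
  have proj: "norm (fst p) \<le> norm p" "norm (snd p) \<le> norm p"
    using norm_fst_le[of "fst p" "snd p"] norm_snd_le[of "snd p" "fst p"] by simp_all
  have "l1_norm p \<le> (\<Sum>i\<in>(UNIV::'m set). \<Sum>j\<in>(UNIV::'n set). norm p) +
      (\<Sum>i\<in>(UNIV::'m set). \<Sum>j\<in>(UNIV::'n set). norm p)"
    unfolding l1_norm_def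
    by (intro add_mono sum_mono order_trans[OF entry]) (rule proj)+
  then show ?thesis by (simp add: mult_ac)
qed

lemma l1_norm_lipschitz:
  fixes p q :: "('m::{finite,linorder}, 'n::{finite,linorder}) field2"
  shows "\<bar>l1_norm p - l1_norm q\<bar> \<le> 2 * real CARD('m) * real CARD('n) * norm (p - q)"
  using l1_norm_triangle[of "p - q" q] l1_norm_triangle[of "q - p" p]
    l1_norm_le_norm[of "p - q"] l1_norm_le_norm[of "q - p"]
  by (simp add: norm_minus_commute)

lemma tendsto_l1_norm:
  assumes "(p \<longlongrightarrow> q) F"
  shows "((\<lambda>x. l1_norm (p x)) \<longlongrightarrow> l1_norm q) F"
  unfolding l1_norm_def by (intro tendsto_intros assms)

section \<open>The reciprocal of the norm\<close>

text \<open>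
  The function \<open>q \<mapsto> 1 / \<surd>q\<close> is convex; this is its tangent inequality at \<open>q = t\<^sup>2\<close>.
\<close>

lemma inverse_tangent_square:
  fixes s t :: real
  assumes "s > 0" "t > 0"
  shows "1 / t - (s\<^sup>2 - t\<^sup>2) / (2 * t ^ 3) \<le> 1 / s"
proof -
  have "1 / s - (1 / t - (s\<^sup>2 - t\<^sup>2) / (2 * t ^ 3)) = (s - t)\<^sup>2 * (s + 2 * t) / (2 * s * t ^ 3)"
    using assms by (simp add: field_simps power2_eq_square power3_eq_cube)
  also have "\<dots> \<ge> 0" using assms by simp
  finally show ?thesis by simp
qed

text \<open>
  The subtracted quadratic term depends only on \<open>norm h\<close>, so \<open>g\<close> may be arbitrarily close to zero.
\<close>

lemma inverse_norm_lower_bound: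
  fixes g h :: "'a::real_inner"
  assumes "g \<noteq> 0" "h \<noteq> 0"
  shows "1 / norm h - (h \<bullet> (g - h)) / norm h ^ 3 - (norm (g - h))\<^sup>2 / (2 * norm h ^ 3) \<le> 1 / norm g"
proof -
  have "(norm g)\<^sup>2 - (norm h)\<^sup>2 = 2 * (h \<bullet> (g - h)) + (norm (g - h))\<^sup>2"
    by (simp add: power2_norm_eq_inner algebra_simps inner_commute)
  then have "((norm g)\<^sup>2 - (norm h)\<^sup>2) / (2 * norm h ^ 3) =
      (h \<bullet> (g - h)) / norm h ^ 3 + (norm (g - h))\<^sup>2 / (2 * norm h ^ 3)"
    by (simp add: add_divide_distrib)
  then show ?thesis
    using inverse_tangent_square[of "norm g" "norm h"] assms by simp
qed

text \<open>
  Up to sign, \<open>h / \<parallel>h\<parallel>\<^sup>3\<close> is the gradient of \<open>1 / \<parallel>h\<parallel>\<close>.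
\<close>

lemma lipschitz_div_norm_cubed:
  fixes g h :: "'a::real_normed_vector"
  assumes "\<epsilon> > 0" "norm g \<ge> \<epsilon>" "norm h \<ge> \<epsilon>"
  shows "norm ((1 / norm h ^ 3) *\<^sub>R h - (1 / norm g ^ 3) *\<^sub>R g) \<le> 4 / \<epsilon> ^ 3 * norm (h - g)"
proof -
  define s t where "s = norm h" and "t = norm g"
  have pos: "s > 0" "t > 0" "s \<ge> \<epsilon>" "t \<ge> \<epsilon>" using assms by (auto simp: s_def t_def)
  have st: "\<bar>t - s\<bar> \<le> norm (h - g)"
    unfolding s_def t_def using norm_triangle_ineq3[of g h] by (simp add: norm_minus_commute)
  have eq: "(1 / s ^ 3 - 1 / t ^ 3) * t = (t - s) * (1 / s ^ 3 + 1 / (s * s * t) + 1 / (s * t * t))"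
    using pos by (simp add: field_simps power3_eq_cube)
  have le: "1 / (x * y * z) \<le> 1 / \<epsilon> ^ 3" if "x \<ge> \<epsilon>" "y \<ge> \<epsilon>" "z \<ge> \<epsilon>" for x y z
    unfolding power3_eq_cube using that assms by (intro divide_left_mono mult_mono mult_pos_pos) auto
  have "\<bar>1 / s ^ 3 - 1 / t ^ 3\<bar> * t = \<bar>t - s\<bar> * (1 / s ^ 3 + 1 / (s * s * t) + 1 / (s * t * t))"
    using arg_cong[OF eq, of abs] pos by (simp add: abs_mult)
  also have "\<dots> \<le> norm (h - g) * (3 / \<epsilon> ^ 3)"
    using le[of s s s] le[of s s t] le[of s t t] pos st
    by (intro mult_mono) (auto simp: power3_eq_cube)
  finally have second: "\<bar>1 / s ^ 3 - 1 / t ^ 3\<bar> * t \<le> norm (h - g) * (3 / \<epsilon> ^ 3)" .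
  have "(1 / s ^ 3) *\<^sub>R h - (1 / t ^ 3) *\<^sub>R g = (1 / s ^ 3) *\<^sub>R (h - g) + (1 / s ^ 3 - 1 / t ^ 3) *\<^sub>R g"
    by (simp add: algebra_simps)
  then have "norm ((1 / s ^ 3) *\<^sub>R h - (1 / t ^ 3) *\<^sub>R g) \<le> 1 / s ^ 3 * norm (h - g) + \<bar>1 / s ^ 3 - 1 / t ^ 3\<bar> * t"
    using norm_triangle_ineq[of "(1 / s ^ 3) *\<^sub>R (h - g)" "(1 / s ^ 3 - 1 / t ^ 3) *\<^sub>R g"] pos
    by (simp add: t_def)
  also have "\<dots> \<le> 1 / \<epsilon> ^ 3 * norm (h - g) + norm (h - g) * (3 / \<epsilon> ^ 3)"
    using le[of s s s] pos second by (intro add_mono mult_right_mono) (auto simp: power3_eq_cube)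
  finally show ?thesis by (simp add: s_def t_def field_simps)
qed

section \<open>One sweep of the iteration\<close>

lemma tendsto_L_uncon:
  assumes "linear A" "us \<longlonglongrightarrow> u" "hs \<longlonglongrightarrow> h" "bs \<longlonglongrightarrow> b" "h \<noteq> 0"
  shows "(\<lambda>k. L_uncon bc lam A f \<rho> (us k) (hs k) (bs k)) \<longlonglongrightarrow> L_uncon bc lam A f \<rho> u h b"
proof -
  have "(\<lambda>k. A (us k)) \<longlonglongrightarrow> A u"
    using assms(1,2) linear_conv_bounded_linear bounded_linear.tendsto by blast
  moreover have "(\<lambda>k. grad bc (us k)) \<longlonglongrightarrow> grad bc u"
    using assms(2) bounded_linear_grad bounded_linear.tendsto by blast
  ultimately show ?thesis
    unfolding L_uncon_def using assms by (intro tendsto_intros tendsto_l1_norm) auto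
qed

lemma half_norm_square:
  fixes x y :: "'a::real_inner"
  shows "(norm ((1/2) *\<^sub>R (x + y)))\<^sup>2 = (norm x)\<^sup>2 / 2 + (norm y)\<^sup>2 / 2 - (norm (x - y))\<^sup>2 / 4"
  by (simp add: power2_norm_eq_inner algebra_simps inner_commute add_divide_distrib diff_divide_distrib)

text \<open>
  Comparing the minimiser with the midpoint of \<open>u\<close> and \<open>v\<close> uses the curvature of the penalty term.
\<close>

lemma u_step_descent:
  assumes "lam > 0" "linear A" "\<rho> > 0"
    and min: "\<And>w. L_uncon bc lam A f \<rho> u h b \<le> L_uncon bc lam A f \<rho> w h b"
  shows "L_uncon bc lam A f \<rho> u h b \<le> L_uncon bc lam A f \<rho> v h b
      - \<rho> / 4 * (norm (grad bc u - grad bc v))\<^sup>2"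
proof -
  define w where "w = (1/2) *\<^sub>R (u + v)"
  have gw: "grad bc w = (1/2) *\<^sub>R (grad bc u + grad bc v)"
    unfolding w_def by (simp add: linear_add[OF linear_grad] linear_scale[OF linear_grad] algebra_simps)
  have Aw: "A w = (1/2) *\<^sub>R (A u + A v)"
    unfolding w_def by (simp add: linear_add[OF assms(2)] linear_scale[OF assms(2)] algebra_simps)
  have "l1_norm (grad bc w) \<le> (l1_norm (grad bc u) + l1_norm (grad bc v)) / 2"
    unfolding gw l1_norm_scaleR using l1_norm_triangle[of "grad bc u" "grad bc v"] by simp
  then have "l1_norm (grad bc w) / norm h \<le> ((l1_norm (grad bc u) + l1_norm (grad bc v)) / 2) / norm h"
    by (rule divide_right_mono) simp
  then have 1: "l1_norm (grad bc w) / norm h \<le> l1_norm (grad bc u) / norm h / 2 + l1_norm (grad bc v) / norm h / 2"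
    by (simp add: add_divide_distrib)
  have "A w - f = (1/2) *\<^sub>R ((A u - f) + (A v - f))"
    unfolding Aw using scaleR_half_double[of f] by (simp add: algebra_simps)
  then have "(norm (A w - f))\<^sup>2 \<le> (norm (A u - f))\<^sup>2 / 2 + (norm (A v - f))\<^sup>2 / 2"
    by (simp only: half_norm_square) simp
  then have 2: "lam / 2 * (norm (A w - f))\<^sup>2 \<le> lam / 2 * ((norm (A u - f))\<^sup>2 / 2 + (norm (A v - f))\<^sup>2 / 2)"
    using assms(1) by (intro mult_left_mono) auto
  have "h - grad bc w = (1/2) *\<^sub>R ((h - grad bc u) + (h - grad bc v))"
    unfolding gw using scaleR_half_double[of h] by (simp add: algebra_simps)
  then have 3: "(norm (h - grad bc w))\<^sup>2 = (norm (h - grad bc u))\<^sup>2 / 2 + (norm (h - grad bc v))\<^sup>2 / 2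
      - (norm (grad bc u - grad bc v))\<^sup>2 / 4"
    by (simp only: half_norm_square) (simp add: norm_minus_commute)
  have 4: "b \<bullet> (grad bc w - h) = b \<bullet> (grad bc u - h) / 2 + b \<bullet> (grad bc v - h) / 2"
    unfolding gw by (simp add: inner_diff_right inner_add_right field_simps)
  have "L_uncon bc lam A f \<rho> w h b \<le> L_uncon bc lam A f \<rho> u h b / 2 + L_uncon bc lam A f \<rho> v h b / 2
      - \<rho> / 8 * (norm (grad bc u - grad bc v))\<^sup>2"
    unfolding L_uncon_def using 1 2 arg_cong[OF 3, of "(*) (\<rho> / 2)"] arg_cong[OF 4, of "(*) \<rho>"]
    by (simp only: distrib_left right_diff_distrib) argo
  with min[of w] show ?thesis by simp
qed

text \<open>
  The left-hand side is the multiplier after its update, so the new multiplier is a function of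
  \<open>\<nabla>u\<close> and \<open>h\<close> alone.
\<close>

lemma h_step_stationary:
  fixes h b :: "('m::{finite,linorder}, 'n::{finite,linorder}) field2"
  assumes "\<rho> > 0" "h \<noteq> 0"
    and min: "\<And>g. g \<noteq> 0 \<Longrightarrow> L_uncon bc lam A f \<rho> u h b \<le> L_uncon bc lam A f \<rho> u g b"
  shows "b + grad bc u - h = - (l1_norm (grad bc u) / (\<rho> * norm h ^ 3)) *\<^sub>R h"
proof -
  define c where "c = l1_norm (grad bc u)"
  define D where "D d = - c * (h \<bullet> d) / norm h ^ 3 - \<rho> * (b \<bullet> d) + \<rho> * ((h - grad bc u) \<bullet> d)" for d
  have quad: "L_uncon bc lam A f \<rho> u g b = c / norm g + lam / 2 * (norm (A u - f))\<^sup>2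
     + \<rho> * (b \<bullet> (grad bc u - g)) + \<rho> / 2 * ((g - grad bc u) \<bullet> (g - grad bc u))" for g
    by (simp add: L_uncon_def c_def power2_norm_eq_inner)
  have norm': "(norm has_derivative (\<lambda>d. d \<bullet> sgn h)) (at h)"
    using has_derivative_norm[OF assms(2)] .
  have "((\<lambda>g. c / norm g) has_derivative (\<lambda>d. - c * (h \<bullet> d) / norm h ^ 3)) (at h)"
    by (rule has_derivative_eq_rhs[OF has_derivative_divide[OF has_derivative_const norm']])
      (use assms(2) in \<open>auto simp: sgn_div_norm divide_simps power3_eq_cube inner_commute intro!: ext\<close>)
  moreover have "((\<lambda>g. lam / 2 * (norm (A u - f))\<^sup>2 + \<rho> * (b \<bullet> (grad bc u - g))
      + \<rho> / 2 * ((g - grad bc u) \<bullet> (g - grad bc u))) has_derivative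
      (\<lambda>d. - \<rho> * (b \<bullet> d) + \<rho> * ((h - grad bc u) \<bullet> d))) (at h)"
    by (auto intro!: derivative_eq_intros ext simp: inner_commute algebra_simps)
  ultimately have "((\<lambda>g. L_uncon bc lam A f \<rho> u g b) has_derivative D) (at h)"
    unfolding quad D_def
    by (rule has_derivative_add[THEN has_derivative_eq_rhs, THEN has_derivative_transform_within[where d=1]])
      (auto simp: algebra_simps)
  then have "D = (\<lambda>v. 0)"
    by (rule differential_zero_maxmin[rotated 2, where S = "- {0}"]) (use assms in auto)
  \<comment> \<open>The residual \<open>r\<close> is \<open>- 1 / \<rho>\<close> times the gradient represented by \<open>D\<close>.\<close>
  define r where "r = b + grad bc u - h + (c / (\<rho> * norm h ^ 3)) *\<^sub>R h"
  have "D r = - \<rho> * (r \<bullet> r)"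
    unfolding D_def using assms by (simp add: r_def[THEN arg_cong[of _ _ "\<lambda>x. x \<bullet> r"]] inner_commute algebra_simps)
  then have "r = 0" using \<open>D = (\<lambda>v. 0)\<close> assms by simp
  then show ?thesis by (simp add: r_def c_def eq_neg_iff_add_eq_0)
qed

lemma h_step_descent:
  fixes h g b :: "('m::{finite,linorder}, 'n::{finite,linorder}) field2"
  assumes "h \<noteq> 0" "g \<noteq> 0" "\<rho> > 0"
    and stat: "b + grad bc u - h = - (l1_norm (grad bc u) / (\<rho> * norm h ^ 3)) *\<^sub>R h"
  shows "L_uncon bc lam A f \<rho> u h b \<le> L_uncon bc lam A f \<rho> u g b
     - (\<rho> / 2 - l1_norm (grad bc u) / (2 * norm h ^ 3)) * (norm (g - h))\<^sup>2"
proof -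
  define c where "c = l1_norm (grad bc u)"
  define w where "w = grad bc u"
  have "c * (1 / norm h - (h \<bullet> (g - h)) / norm h ^ 3 - (norm (g - h))\<^sup>2 / (2 * norm h ^ 3)) \<le> c * (1 / norm g)"
    by (intro mult_left_mono inverse_norm_lower_bound assms) (simp add: c_def l1_norm_nonneg)
  then have 1: "c / norm h - c * (h \<bullet> (g - h)) / norm h ^ 3 - c / (2 * norm h ^ 3) * (norm (g - h))\<^sup>2 \<le> c / norm g"
    by (simp add: algebra_simps)
  have "\<rho> * ((b + w - h) \<bullet> (g - h)) = - (c * (h \<bullet> (g - h)) / norm h ^ 3)"
    using assms unfolding w_def stat c_def by simp
  moreover have "\<rho> * ((b + w - h) \<bullet> (g - h)) =
      \<rho> * (b \<bullet> (w - h)) + \<rho> / 2 * (norm (h - w))\<^sup>2 + \<rho> / 2 * (norm (g - h))\<^sup>2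
      - \<rho> * (b \<bullet> (w - g)) - \<rho> / 2 * (norm (g - w))\<^sup>2"
    unfolding power2_norm_eq_inner by (simp add: inner_commute algebra_simps)
  ultimately show ?thesis
    using 1 unfolding L_uncon_def w_def[symmetric] c_def[unfolded w_def[symmetric], symmetric]
    by (simp only: left_diff_distrib)
qed

text \<open>
  The right-hand side does not involve \<open>\<rho>\<close>, hence \<open>\<rho> \<parallel>b - b'\<parallel>\<^sup>2\<close> is of order \<open>1 / \<rho>\<close>.
\<close>

lemma multiplier_change:
  fixes p q g h b b' :: "('m::{finite,linorder}, 'n::{finite,linorder}) field2"
  assumes "\<epsilon> > 0" "norm g \<ge> \<epsilon>" "norm h \<ge> \<epsilon>" "\<rho> > 0" "l1_norm q \<le> M"
    and b: "b = - (l1_norm p / (\<rho> * norm h ^ 3)) *\<^sub>R h"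
    and b': "b' = - (l1_norm q / (\<rho> * norm g ^ 3)) *\<^sub>R g"
  shows "\<rho> * norm (b - b') \<le> 2 * real CARD('m) * real CARD('n) / \<epsilon>\<^sup>2 * norm (p - q)
      + 4 * (M / \<epsilon> ^ 3) * norm (h - g)"
proof -
  define H G where "H = (1 / norm h ^ 3) *\<^sub>R h" and "G = (1 / norm g ^ 3) *\<^sub>R g"
  have "h \<noteq> 0" using assms by auto
  then have "norm H = 1 / (norm h)\<^sup>2"
    by (simp add: H_def power2_eq_square power3_eq_cube)
  also have "\<dots> \<le> 1 / \<epsilon>\<^sup>2"
    using assms by (intro divide_left_mono power_mono mult_pos_pos) auto
  finally have H: "norm H \<le> 1 / \<epsilon>\<^sup>2" .
  have HG: "norm (H - G) \<le> 4 / \<epsilon> ^ 3 * norm (h - g)"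
    unfolding H_def G_def by (rule lipschitz_div_norm_cubed) fact+
  have "\<rho> *\<^sub>R (b' - b) = (l1_norm p - l1_norm q) *\<^sub>R H + l1_norm q *\<^sub>R (H - G)"
    unfolding b b' H_def G_def using \<open>\<rho> > 0\<close>
    by (simp add: algebra_simps diff_divide_distrib)
  then have "\<rho> * norm (b' - b) \<le> \<bar>l1_norm p - l1_norm q\<bar> * norm H + l1_norm q * norm (H - G)"
    using norm_triangle_ineq[of "(l1_norm p - l1_norm q) *\<^sub>R H" "l1_norm q *\<^sub>R (H - G)"]
      norm_scaleR[of \<rho> "b' - b"] assms l1_norm_nonneg[of q] by simp
  also have "\<dots> \<le> (2 * real CARD('m) * real CARD('n) * norm (p - q)) * (1 / \<epsilon>\<^sup>2)
      + M * (4 / \<epsilon> ^ 3 * norm (h - g))"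
    using assms H HG l1_norm_lipschitz[of p q] l1_norm_nonneg[of q]
    by (intro add_mono mult_mono) auto
  finally show ?thesis by (simp add: norm_minus_commute algebra_simps)
qed

text \<open>
  One sweep from \<open>(v, g, c)\<close> to \<open>(u, h, b)\<close>. Its steps change the Lagrangian by at most
  \<open>- \<rho> / 4 \<parallel>\<nabla>u - \<nabla>v\<parallel>\<^sup>2\<close>, \<open>- \<rho> / 4 \<parallel>h - g\<parallel>\<^sup>2\<close> and \<open>+ \<rho> / 8\<close> times the sum of both squares. The assumption
  on \<open>c\<close> says that the old multiplier is itself the outcome of an \<open>h\<close>-step; initial values
  need not satisfy it.
\<close>

lemma lagrangian_decrease:
  fixes u v :: "('m::{finite,linorder}, 'n::{finite,linorder}) img"
    and A :: "('m, 'n) img \<Rightarrow> 'd::euclidean_space"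
  assumes "lam > 0" "linear A" "\<epsilon> > 0" "M \<ge> 0" "\<rho> > 0"
    and rho: "\<rho> \<ge> 4 * (2 * real CARD('m) * real CARD('n) / \<epsilon>\<^sup>2)" "\<rho> \<ge> 16 * (M / \<epsilon> ^ 3)"
    and norms: "norm g \<ge> \<epsilon>" "norm h \<ge> \<epsilon>"
    and l1: "l1_norm (grad bc u) \<le> M" "l1_norm (grad bc v) \<le> M"
    and c: "c = - (l1_norm (grad bc v) / (\<rho> * norm g ^ 3)) *\<^sub>R g"
    and u_min: "\<And>w. L_uncon bc lam A f \<rho> u g c \<le> L_uncon bc lam A f \<rho> w g c"
    and h_min: "\<And>w. w \<noteq> 0 \<Longrightarrow> L_uncon bc lam A f \<rho> u h c \<le> L_uncon bc lam A f \<rho> u w c"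
    and b: "b = c + grad bc u - h"
  shows "L_uncon bc lam A f \<rho> u h b \<le> L_uncon bc lam A f \<rho> v g c
      - \<rho> / 8 * ((norm (grad bc u - grad bc v))\<^sup>2 + (norm (h - g))\<^sup>2)"
proof -
  define a x P H where "a = 2 * real CARD('m) * real CARD('n) / \<epsilon>\<^sup>2" and "x = M / \<epsilon> ^ 3"
    and "P = norm (grad bc u - grad bc v)" and "H = norm (h - g)"
  have nz: "h \<noteq> 0" "g \<noteq> 0" using norms assms by auto
  have ax: "a \<ge> 0" "x \<ge> 0" "P \<ge> 0" "H \<ge> 0" using assms by (auto simp: a_def x_def P_def H_def)
  have 1: "L_uncon bc lam A f \<rho> u g c \<le> L_uncon bc lam A f \<rho> v g c - \<rho> / 4 * P\<^sup>2"
    unfolding P_def by (rule u_step_descent) fact+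
  note stat = h_step_stationary[OF \<open>\<rho> > 0\<close> nz(1) h_min]
  have "L_uncon bc lam A f \<rho> u h c \<le> L_uncon bc lam A f \<rho> u g c
     - (\<rho> / 2 - l1_norm (grad bc u) / (2 * norm h ^ 3)) * H\<^sup>2"
    using h_step_descent[OF nz \<open>\<rho> > 0\<close> stat] by (simp add: H_def norm_minus_commute)
  moreover have "l1_norm (grad bc u) / (2 * norm h ^ 3) \<le> M / (2 * \<epsilon> ^ 3)"
    using assms l1_norm_nonneg[of "grad bc u"] by (intro frac_le mult_left_mono power_mono) auto
  then have "(\<rho> / 2 - x / 2) * H\<^sup>2 \<le> (\<rho> / 2 - l1_norm (grad bc u) / (2 * norm h ^ 3)) * H\<^sup>2"
    by (intro mult_right_mono) (auto simp: x_def)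
  moreover have "\<rho> / 4 * H\<^sup>2 \<le> (\<rho> / 2 - x / 2) * H\<^sup>2"
    using rho(2) \<open>\<rho> > 0\<close> ax by (intro mult_right_mono) (auto simp: x_def[symmetric])
  ultimately have 2: "L_uncon bc lam A f \<rho> u h c \<le> L_uncon bc lam A f \<rho> u g c - \<rho> / 4 * H\<^sup>2"
    by linarith
  \<comment> \<open>The two lower bounds on \<open>\<rho>\<close> are exactly what turns \<open>a\<close> and \<open>4 * x\<close> into \<open>\<rho> / 4\<close>.\<close>
  have "\<rho> * norm (b - c) \<le> a * P + 4 * x * H"
    unfolding a_def x_def P_def H_def
    by (rule multiplier_change) (use assms stat in auto)
  also have "\<dots> \<le> \<rho> / 4 * P + \<rho> / 4 * H"
    using rho ax by (intro add_mono mult_right_mono) (auto simp: a_def x_def)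
  finally have "\<rho> * norm (b - c) \<le> \<rho> * ((P + H) / 4)" by (simp add: algebra_simps)
  then have "norm (b - c) \<le> (P + H) / 4" using \<open>\<rho> > 0\<close> by simp
  then have "(norm (b - c))\<^sup>2 \<le> ((P + H) / 4)\<^sup>2" by (intro power_mono) auto
  also have "\<dots> \<le> (P\<^sup>2 + H\<^sup>2) / 8"
    using sum_squares_bound[of P H] by (simp add: power2_eq_square field_simps)
  finally have 3: "\<rho> * (norm (b - c))\<^sup>2 \<le> \<rho> * ((P\<^sup>2 + H\<^sup>2) / 8)"
    using \<open>\<rho> > 0\<close> by (intro mult_left_mono) auto
  have "b - c = grad bc u - h" using b by simp
  then have "b \<bullet> (grad bc u - h) = c \<bullet> (grad bc u - h) + (norm (b - c))\<^sup>2"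
    by (simp add: power2_norm_eq_inner b algebra_simps)
  then have "L_uncon bc lam A f \<rho> u h b = L_uncon bc lam A f \<rho> u h c + \<rho> * (norm (b - c))\<^sup>2"
    unfolding L_uncon_def by (simp add: distrib_left)
  with 1 2 3 show ?thesis unfolding P_def H_def by (simp add: algebra_simps)
qed

lemma lagrangian_lower_bound:
  assumes "lam > 0" "\<rho> > 0"
  shows "- \<rho> / 2 * (norm b)\<^sup>2 \<le> L_uncon bc lam A f \<rho> u h b"
proof -
  have "(norm (b + (grad bc u - h)))\<^sup>2 = (norm b)\<^sup>2 + 2 * (b \<bullet> (grad bc u - h)) + (norm (h - grad bc u))\<^sup>2"
    by (simp add: power2_norm_eq_inner algebra_simps inner_commute)
  then have "0 \<le> \<rho> / 2 * ((norm b)\<^sup>2 + 2 * (b \<bullet> (grad bc u - h)) + (norm (h - grad bc u))\<^sup>2)"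
    using assms by (metis less_imp_le mult_nonneg_nonneg half_gt_zero zero_le_power2)
  moreover have "0 \<le> l1_norm (grad bc u) / norm h" "0 \<le> lam / 2 * (norm (A u - f))\<^sup>2"
    using assms by (auto simp: l1_norm_nonneg)
  ultimately show ?thesis by (simp add: L_uncon_def algebra_simps)
qed

section \<open>A sufficient condition for criticality\<close>

lemma zero_in_frechet_subdifferential:
  fixes F :: "'a::euclidean_space \<Rightarrow> ereal"
  assumes "F x = ereal a" "\<delta> > 0"
    and lower: "\<And>y. norm (y - x) < \<delta> \<Longrightarrow> ereal (a - K * (norm (y - x))\<^sup>2) \<le> F y"
  shows "0 \<in> frechet_subdifferential F x"
proof -
  have quotient: "ereal (- K * norm (y - x)) \<le> (F y - F x - ereal (0 \<bullet> (y - x))) / ereal (norm (y - x))"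
    if "y \<noteq> x" "norm (y - x) < \<delta>" for y
  proof (cases "F y")
    case (real c)
    then have "- K * norm (y - x) \<le> (c - a) / norm (y - x)"
      using lower[OF that(2)] that(1) by (simp add: pos_le_divide_eq power2_eq_square algebra_simps)
    then show ?thesis using real assms(1) that(1) by simp
  next
    case PInf
    then show ?thesis using assms(1) that(1) by simp
  next
    case MInf
    then show ?thesis using lower[OF that(2)] by simp
  qed
  have "((\<lambda>y. ereal (- K * norm (y - x))) \<longlongrightarrow> ereal (- K * norm (x - x))) (at x)"
    by (intro tendsto_intros)
  then have "0 = Liminf (at x) (\<lambda>y. ereal (- K * norm (y - x)))"
    by (subst lim_imp_Liminf) (auto simp: zero_ereal_def)
  also have "\<dots> \<le> Liminf (at x) (\<lambda>y. (F y - F x - ereal (0 \<bullet> (y - x))) / ereal (norm (y - x)))"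
    by (intro Liminf_mono) (use quotient assms(2) in \<open>auto simp: eventually_at dist_norm\<close>)
  finally show ?thesis using assms(1) by (simp add: frechet_subdifferential_def)
qed

lemma frechet_imp_limiting:
  assumes "v \<in> frechet_subdifferential F x"
  shows "v \<in> limiting_subdifferential F x"
proof -
  have "\<bar>F x\<bar> \<noteq> \<infinity>" using assms by (simp add: frechet_subdifferential_def)
  with assms show ?thesis
    unfolding limiting_subdifferential_def
    by (intro CollectI conjI exI[of _ "\<lambda>_. x"] exI[of _ "\<lambda>_. v"]) simp_all
qed

text \<open>
  The total-variation term is handled by splitting \<open>L(u, h, b) - L(u\<^sup>*, h\<^sup>*, b\<^sup>*)\<close> at \<open>L(u, h\<^sup>*, b\<^sup>*)\<close>:
  the difference in \<open>u\<close> is nonnegative by minimality, and the rest is smooth in \<open>(h, b)\<close>. There the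
  first-order terms \<open>- \<parallel>\<nabla>u\<parallel>\<^sub>1 h\<^sup>* \<bullet> (h - h\<^sup>*) / \<parallel>h\<^sup>*\<parallel>\<^sup>3\<close> and \<open>- \<rho> b\<^sup>* \<bullet> (h - h\<^sup>*)\<close> add up to
  \<open>(\<parallel>\<nabla>u\<^sup>*\<parallel>\<^sub>1 - \<parallel>\<nabla>u\<parallel>\<^sub>1) h\<^sup>* \<bullet> (h - h\<^sup>*) / \<parallel>h\<^sup>*\<parallel>\<^sup>3\<close>, which is of second order because
  \<open>u \<mapsto> \<parallel>\<nabla>u\<parallel>\<^sub>1\<close> is Lipschitz.
\<close>

lemma critical_pointI:
  fixes us :: "('m::{finite,linorder}, 'n::{finite,linorder}) img"
    and A :: "('m, 'n) img \<Rightarrow> 'd::euclidean_space"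
  assumes "\<rho> > 0" "hs \<noteq> 0" "hs = grad bc us"
    and bs: "bs = - (l1_norm (grad bc us) / (\<rho> * norm hs ^ 3)) *\<^sub>R hs"
    and u_min: "\<And>v. L_uncon bc lam A f \<rho> us hs bs \<le> L_uncon bc lam A f \<rho> v hs bs"
  shows "critical_point bc lam A f \<rho> us hs"
proof -
  obtain B where B: "B > 0" "\<And>v. norm (grad bc v :: ('m, 'n) field2) \<le> norm v * B"
    using bounded_linear.pos_bounded[OF bounded_linear_grad] by blast
  define C where "C = 2 * real CARD('m) * real CARD('n)"
  define t where "t = norm hs"
  define cs where "cs = l1_norm (grad bc us)"
  define K where "K = C * B / t\<^sup>2 + (cs + C * B) / (2 * t ^ 3) + \<rho> * (2 * B + 1)"
  have t: "t > 0" using assms by (simp add: t_def)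
  have C: "C \<ge> 0" by (simp add: C_def)
  have lower: "L_uncon bc lam A f \<rho> us hs bs - K * r\<^sup>2 \<le> L_uncon bc lam A f \<rho> u h b"
    if r: "norm ((u, h, b) - (us, hs, bs)) = r" "r \<le> 1" "h \<noteq> 0" for u h b r
  proof -
    define d e w c where "d = h - hs" and "e = b - bs" and "w = grad bc u - hs" and "c = l1_norm (grad bc u)"
    have comp: "norm (u - us) \<le> r" "norm d \<le> r" "norm e \<le> r"
      using norm_fst_le[of "u - us" "(d, e)"] norm_snd_le[of "(d, e)" "u - us"]
        norm_fst_le[of d e] norm_snd_le[of e d] r(1) by (auto simp: d_def e_def)
    then have r0: "r \<ge> 0" using norm_ge_zero order_trans by blast
    have "w = grad bc (u - us)"
      unfolding w_def assms(3) by (simp add: linear_diff[OF linear_grad])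
    then have "norm w = norm (grad bc (u - us))" by simp
    then have w: "norm w \<le> B * r"
      using B(2)[of "u - us"] mult_right_mono[OF comp(1) less_imp_le[OF B(1)]]
        mult.commute[of B r] by linarith
    have "\<bar>c - cs\<bar> \<le> C * norm w"
      unfolding c_def cs_def C_def w_def assms(3) by (rule l1_norm_lipschitz)
    also have "\<dots> \<le> C * (B * r)" using w C by (rule mult_left_mono)
    finally have ccs: "\<bar>c - cs\<bar> \<le> C * B * r" by (simp add: mult.assoc)
    have "C * B * r \<le> C * B" using r(2) C B by (simp add: mult_left_le)
    with ccs have c: "c \<le> cs + C * B" by linarith
    have c0: "c \<ge> 0" by (simp add: c_def l1_norm_nonneg)
    have "\<bar>hs \<bullet> d\<bar> \<le> t * r"
      unfolding t_def by (rule order_trans[OF Cauchy_Schwarz_ineq2 mult_left_mono[OF comp(2)]]) simp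
    then have "\<bar>cs - c\<bar> * \<bar>hs \<bullet> d\<bar> \<le> (C * B * r) * (t * r)"
      using ccs by (intro mult_mono) auto
    then have "\<bar>(cs - c) * (hs \<bullet> d)\<bar> / t ^ 3 \<le> (C * B * r) * (t * r) / t ^ 3"
      unfolding abs_mult using t by (intro divide_right_mono) auto
    also have "\<dots> = C * B / t\<^sup>2 * r\<^sup>2" using t by (simp add: power2_eq_square power3_eq_cube)
    finally have "\<bar>(cs - c) * (hs \<bullet> d) / t ^ 3\<bar> \<le> C * B / t\<^sup>2 * r\<^sup>2" using t by simp
    then have 1: "(cs - c) * (hs \<bullet> d) / t ^ 3 \<ge> - (C * B / t\<^sup>2 * r\<^sup>2)"
      using abs_le_D2 minus_le_iff by blast
    have "c * (norm d)\<^sup>2 \<le> (cs + C * B) * r\<^sup>2"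
      using c c0 comp(2) by (intro mult_mono power_mono) auto
    then have 2: "c * (norm d)\<^sup>2 / (2 * t ^ 3) \<le> (cs + C * B) / (2 * t ^ 3) * r\<^sup>2"
      using divide_right_mono[of "c * (norm d)\<^sup>2" "(cs + C * B) * r\<^sup>2" "2 * t ^ 3"] t by simp
    have ip: "\<bar>x \<bullet> y\<bar> \<le> p * q" if "norm x \<le> p" "norm y \<le> q" for x y :: "('m, 'n) field2" and p q
      using Cauchy_Schwarz_ineq2[of x y] mult_mono[OF that] that norm_ge_zero[of x]
      by (meson norm_ge_zero order_trans)
    have "e \<bullet> w - e \<bullet> d - d \<bullet> w \<ge> - (r * (B * r)) - r * r - r * (B * r)"
      using ip[OF comp(3) w] ip[OF comp(3,2)] ip[OF comp(2) w] by linarith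
    then have 3: "\<rho> * (e \<bullet> w - e \<bullet> d - d \<bullet> w) \<ge> - (\<rho> * (2 * B + 1) * r\<^sup>2)"
      using mult_left_mono[of "- (r * (B * r)) - r * r - r * (B * r)" "e \<bullet> w - e \<bullet> d - d \<bullet> w" \<rho>] \<open>\<rho> > 0\<close>
      by (simp add: power2_eq_square algebra_simps)
    have "c * (1 / norm hs - (hs \<bullet> d) / norm hs ^ 3 - (norm d)\<^sup>2 / (2 * norm hs ^ 3)) \<le> c * (1 / norm h)"
      unfolding d_def by (intro mult_left_mono inverse_norm_lower_bound assms r c0)
    then have 4: "c / norm h - c / norm hs \<ge> - c * (hs \<bullet> d) / t ^ 3 - c * (norm d)\<^sup>2 / (2 * t ^ 3)"
      by (simp add: t_def algebra_simps)
    have bsd: "\<rho> * (bs \<bullet> d) = - cs * (hs \<bullet> d) / t ^ 3"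
      unfolding bs using \<open>\<rho> > 0\<close> by (simp add: cs_def t_def)
    have ip_diff: "b \<bullet> (grad bc u - h) = bs \<bullet> (grad bc u - hs) + (e \<bullet> w - e \<bullet> d - bs \<bullet> d)"
      by (simp add: d_def e_def w_def algebra_simps)
    have sq_diff: "(norm (h - grad bc u))\<^sup>2 = (norm (hs - grad bc u))\<^sup>2 + ((norm d)\<^sup>2 - 2 * (d \<bullet> w))"
      by (simp add: d_def w_def power2_norm_eq_inner algebra_simps inner_commute)
    have "L_uncon bc lam A f \<rho> u h b - L_uncon bc lam A f \<rho> u hs bs =
        c / norm h - c / norm hs + \<rho> * (e \<bullet> w - e \<bullet> d - bs \<bullet> d) + \<rho> / 2 * ((norm d)\<^sup>2 - 2 * (d \<bullet> w))"
      unfolding L_uncon_def c_def[symmetric] ip_diff sq_diff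
      by (simp only: distrib_left[of \<rho>] distrib_left[of "\<rho> / 2"])
    also have "\<dots> = c / norm h - c / norm hs + \<rho> * (e \<bullet> w - e \<bullet> d - d \<bullet> w) - \<rho> * (bs \<bullet> d) + \<rho> / 2 * (norm d)\<^sup>2"
      by (simp add: algebra_simps)
    also have "\<dots> \<ge> (cs - c) * (hs \<bullet> d) / t ^ 3 - c * (norm d)\<^sup>2 / (2 * t ^ 3) - \<rho> * (2 * B + 1) * r\<^sup>2"
    proof -
      have "0 \<le> \<rho> / 2 * (norm d)\<^sup>2" using \<open>\<rho> > 0\<close> by simp
      then show ?thesis using 3 4 bsd by (simp add: left_diff_distrib diff_divide_distrib)
    qed
    finally have "- (K * r\<^sup>2) \<le> L_uncon bc lam A f \<rho> u h b - L_uncon bc lam A f \<rho> u hs bs"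
      using 1 2 unfolding K_def by (simp only: distrib_right)
    then show ?thesis using u_min[of u] by linarith
  qed
  have "0 \<in> frechet_subdifferential (L_uncon_ext bc lam A f \<rho>) (us, hs, bs)"
  proof (rule zero_in_frechet_subdifferential[where \<delta> = 1 and K = K])
    show "L_uncon_ext bc lam A f \<rho> (us, hs, bs) = ereal (L_uncon bc lam A f \<rho> us hs bs)"
      using assms(2) by (simp add: L_uncon_ext_def)
    fix y :: "('m, 'n) img \<times> ('m, 'n) field2 \<times> ('m, 'n) field2"
    assume y: "norm (y - (us, hs, bs)) < 1"
    obtain u h b where uhb: "y = (u, h, b)" by (rule prod_cases3)
    show "ereal (L_uncon bc lam A f \<rho> us hs bs - K * (norm (y - (us, hs, bs)))\<^sup>2)
        \<le> L_uncon_ext bc lam A f \<rho> y"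
    proof (cases "h = 0")
      case True
      then show ?thesis by (simp add: L_uncon_ext_def uhb)
    next
      case False
      then show ?thesis
        using lower[OF refl, of u h b] y unfolding uhb L_uncon_ext_def by simp
    qed
  qed simp
  then show ?thesis
    unfolding critical_point_def using assms(2) frechet_imp_limiting by blast
qed

section \<open>Vanishing increments and limit points\<close>

lemma admm_sequenceD:
  assumes "admm_sequence bc lam A f \<rho> u h b"
  shows "L_uncon bc lam A f \<rho> (u (Suc k)) (h k) (b k) \<le> L_uncon bc lam A f \<rho> v (h k) (b k)"
    and "g \<noteq> 0 \<Longrightarrow> L_uncon bc lam A f \<rho> (u (Suc k)) (h (Suc k)) (b k)
      \<le> L_uncon bc lam A f \<rho> (u (Suc k)) g (b k)"
    and "h (Suc k) \<noteq> 0"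
    and "b (Suc k) = b k + grad bc (u (Suc k)) - h (Suc k)"
  using assms unfolding admm_sequence_def is_arg_min_linorder by blast+

lemma admm_stationary:
  assumes "admm_sequence bc lam A f \<rho> u h b" "\<rho> > 0"
  shows "b (Suc k) = - (l1_norm (grad bc (u (Suc k))) / (\<rho> * norm (h (Suc k)) ^ 3)) *\<^sub>R h (Suc k)"
  unfolding admm_sequenceD(4)[OF assms(1)]
  by (rule h_step_stationary[OF assms(2) admm_sequenceD(3,2)[OF assms(1)]])

lemma admm_multiplier_bound:
  assumes "admm_sequence bc lam A f \<rho> u h b" "\<rho> > 0" "\<epsilon> > 0"
    and "l1_norm (grad bc (u (Suc k))) \<le> M" "norm (h (Suc k)) \<ge> \<epsilon>"
  shows "norm (b (Suc k)) \<le> M / (\<rho> * \<epsilon>\<^sup>2)"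
proof -
  have "norm (b (Suc k)) = l1_norm (grad bc (u (Suc k))) / (\<rho> * (norm (h (Suc k)))\<^sup>2)"
    using assms(2) l1_norm_nonneg[of "grad bc (u (Suc k))"] admm_sequenceD(3)[OF assms(1), of k]
    by (simp add: admm_stationary[OF assms(1,2)] power2_eq_square power3_eq_cube)
  also have "\<dots> \<le> M / (\<rho> * \<epsilon>\<^sup>2)"
    using assms l1_norm_nonneg[of "grad bc (u (Suc k))"]
    by (intro frac_le mult_left_mono power_mono) auto
  finally show ?thesis .
qed

lemma admm_increments_vanish:
  fixes u :: "nat \<Rightarrow> ('m::{finite,linorder}, 'n::{finite,linorder}) img"
    and A :: "('m, 'n) img \<Rightarrow> 'd::euclidean_space"
  assumes "lam > 0" "linear A" "\<epsilon> > 0" "M \<ge> 0" "\<rho> > 0"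
    and rho: "\<rho> \<ge> 4 * (2 * real CARD('m) * real CARD('n) / \<epsilon>\<^sup>2)" "\<rho> \<ge> 16 * (M / \<epsilon> ^ 3)"
    and admm: "admm_sequence bc lam A f \<rho> u h b"
    and l1: "\<And>k. l1_norm (grad bc (u k)) \<le> M"
    and norms: "\<And>k. norm (h k) \<ge> \<epsilon>"
  shows "(\<lambda>k. h (Suc k) - h k) \<longlonglongrightarrow> 0" "(\<lambda>k. b (Suc k) - b k) \<longlonglongrightarrow> 0"
proof -
  define a x where "a = 2 * real CARD('m) * real CARD('n) / \<epsilon>\<^sup>2" and "x = M / \<epsilon> ^ 3"
  define P H where "P k = norm (grad bc (u (Suc (Suc k))) - grad bc (u (Suc k)))"
    and "H k = norm (h (Suc (Suc k)) - h (Suc k))" for k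
  \<comment> \<open>The index is shifted because the multiplier formula holds only from the first update on.\<close>
  define \<Lambda> where "\<Lambda> k = L_uncon bc lam A f \<rho> (u (Suc k)) (h (Suc k)) (b (Suc k))" for k
  note stat = admm_stationary[OF admm \<open>\<rho> > 0\<close>]
  have decrease: "\<Lambda> (Suc k) \<le> \<Lambda> k - \<rho> / 8 * ((P k)\<^sup>2 + (H k)\<^sup>2)" for k
    unfolding \<Lambda>_def P_def H_def
    by (rule lagrangian_decrease[OF assms(1-7) norms norms l1 l1 stat admm_sequenceD(1,2,4)[OF admm]])
  have "0 \<le> \<rho> / 8 * ((P k)\<^sup>2 + (H k)\<^sup>2)" for k using \<open>\<rho> > 0\<close> by simp
  then have "\<Lambda> (Suc k) \<le> \<Lambda> k" for k using decrease[of k] by (smt (verit))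
  then have "decseq \<Lambda>" by (simp add: decseq_Suc_iff)
  moreover have "- \<rho> / 2 * (M / (\<rho> * \<epsilon>\<^sup>2))\<^sup>2 \<le> \<Lambda> k" for k
  proof -
    have "\<rho> / 2 * (norm (b (Suc k)))\<^sup>2 \<le> \<rho> / 2 * (M / (\<rho> * \<epsilon>\<^sup>2))\<^sup>2"
      using admm_multiplier_bound[OF admm assms(5,3) l1 norms] \<open>\<rho> > 0\<close>
      by (intro mult_left_mono power_mono) auto
    then show ?thesis
      using lagrangian_lower_bound[OF assms(1,5)] unfolding \<Lambda>_def by (smt (verit) minus_divide_left mult_minus_left)
  qed
  ultimately obtain l where "\<Lambda> \<longlonglongrightarrow> l" using decseq_convergent by blast
  then have "(\<lambda>k. 8 / \<rho> * (\<Lambda> k - \<Lambda> (Suc k))) \<longlonglongrightarrow> 8 / \<rho> * (l - l)"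
    by (intro tendsto_intros LIMSEQ_Suc)
  then have vanish: "(\<lambda>k. 8 / \<rho> * (\<Lambda> k - \<Lambda> (Suc k))) \<longlonglongrightarrow> 0" by simp
  have bound: "(P k)\<^sup>2 + (H k)\<^sup>2 \<le> 8 / \<rho> * (\<Lambda> k - \<Lambda> (Suc k))" for k
    using decrease[of k] \<open>\<rho> > 0\<close> by (simp add: field_simps)
  have "norm ((P k)\<^sup>2) \<le> 8 / \<rho> * (\<Lambda> k - \<Lambda> (Suc k))" for k
    using bound[of k] zero_le_power2[of "H k"] by (simp only: real_norm_def abs_power2)
  then have "(\<lambda>k. (P k)\<^sup>2) \<longlonglongrightarrow> 0"
    by (intro Lim_null_comparison[OF always_eventually vanish]) blast
  moreover have "norm ((H k)\<^sup>2) \<le> 8 / \<rho> * (\<Lambda> k - \<Lambda> (Suc k))" for k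
    using bound[of k] zero_le_power2[of "P k"] by (simp only: real_norm_def abs_power2)
  then have "(\<lambda>k. (H k)\<^sup>2) \<longlonglongrightarrow> 0"
    by (intro Lim_null_comparison[OF always_eventually vanish]) blast
  ultimately have P: "P \<longlonglongrightarrow> 0" and H: "H \<longlonglongrightarrow> 0"
    by (simp_all add: power_tendsto_0_iff)
  show "(\<lambda>k. h (Suc k) - h k) \<longlonglongrightarrow> 0"
    by (rule LIMSEQ_imp_Suc, rule tendsto_norm_zero_cancel) (use H in \<open>simp add: H_def[abs_def]\<close>)
  have "\<rho> * norm (b (Suc (Suc k)) - b (Suc k)) \<le> a * P k + 4 * x * H k" for k
    unfolding a_def x_def P_def H_def
    by (rule multiplier_change[OF assms(3) norms norms assms(5) l1 stat stat])
  then have le: "norm (b (Suc (Suc k)) - b (Suc k)) \<le> (a * P k + 4 * x * H k) / \<rho>" for k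
    using \<open>\<rho> > 0\<close> by (simp add: pos_le_divide_eq mult.commute)
  have "(\<lambda>k. (a * P k + 4 * x * H k) / \<rho>) \<longlonglongrightarrow> (a * 0 + 4 * x * 0) / \<rho>"
    using \<open>\<rho> > 0\<close> by (intro tendsto_intros P H) auto
  then have "(\<lambda>k. (a * P k + 4 * x * H k) / \<rho>) \<longlonglongrightarrow> 0" by simp
  then have "(\<lambda>k. b (Suc (Suc k)) - b (Suc k)) \<longlonglongrightarrow> 0"
    by (rule Lim_null_comparison[OF always_eventually, rotated]) (use le in blast)
  then show "(\<lambda>k. b (Suc k) - b k) \<longlonglongrightarrow> 0" by (rule LIMSEQ_imp_Suc)
qed

lemma bdd_above_l1_norm_grad:
  fixes u :: "nat \<Rightarrow> ('m::{finite,linorder}, 'n::{finite,linorder}) img"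
  assumes "bounded (range u)"
  shows "bdd_above (range (\<lambda>k. l1_norm (grad bc (u k))))"
proof -
  have "bounded ((\<lambda>p. grad bc p) ` range u)"
    using assms bounded_linear_grad by (rule bounded_linear_image)
  then obtain R where R: "\<And>k. norm (grad bc (u k)) \<le> R"
    unfolding bounded_iff by auto
  show ?thesis
  proof (rule bdd_aboveI2)
    show "l1_norm (grad bc (u k)) \<le> 2 * real CARD('m) * real CARD('n) * R" for k
      by (rule order_trans[OF l1_norm_le_norm mult_left_mono[OF R]]) simp
  qed
qed

text \<open>
  Each new \<open>u\<close> is optimal for the previous \<open>h\<close> and \<open>b\<close>; vanishing increments make the previous values
  converge to the same limits.
\<close>

lemma admm_limit_critical:
  assumes "linear A" "\<rho> > 0" "\<epsilon> > 0"
    and admm: "admm_sequence bc lam A f \<rho> u h b"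
    and norms: "\<And>k. norm (h k) \<ge> \<epsilon>"
    and dh: "(\<lambda>k. h (Suc k) - h k) \<longlonglongrightarrow> 0" and db: "(\<lambda>k. b (Suc k) - b k) \<longlonglongrightarrow> 0"
    and r: "strict_mono r"
    and lim: "(\<lambda>k. u (Suc (r k))) \<longlonglongrightarrow> us" "(\<lambda>k. h (Suc (r k))) \<longlonglongrightarrow> hs" "(\<lambda>k. b (Suc (r k))) \<longlonglongrightarrow> bs"
  shows "critical_point bc lam A f \<rho> us hs"
proof -
  have dh': "(\<lambda>k. h (Suc (r k)) - h (r k)) \<longlonglongrightarrow> 0" and db': "(\<lambda>k. b (Suc (r k)) - b (r k)) \<longlonglongrightarrow> 0"
    using LIMSEQ_subseq_LIMSEQ[OF dh r] LIMSEQ_subseq_LIMSEQ[OF db r] by (simp_all add: o_def)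
  have h_old: "(\<lambda>k. h (r k)) \<longlonglongrightarrow> hs" and b_old: "(\<lambda>k. b (r k)) \<longlonglongrightarrow> bs"
    using tendsto_diff[OF lim(2) dh'] tendsto_diff[OF lim(3) db'] by simp_all
  have "norm hs \<ge> \<epsilon>"
    using tendsto_norm[OF lim(2)] by (rule Lim_bounded2[where N = 0]) (use norms in auto)
  then have hs: "hs \<noteq> 0" using assms by auto
  have grad_lim: "(\<lambda>k. grad bc (u (Suc (r k)))) \<longlonglongrightarrow> grad bc us"
    using bounded_linear.tendsto[OF bounded_linear_grad lim(1)] .
  show ?thesis
  proof (rule critical_pointI[where bs = bs])
    have "grad bc (u (Suc (r k))) - h (Suc (r k)) = b (Suc (r k)) - b (r k)" for k
      using admm by (auto simp: admm_sequence_def)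
    then have "(\<lambda>k. b (Suc (r k)) - b (r k)) \<longlonglongrightarrow> grad bc us - hs"
      using tendsto_diff[OF grad_lim lim(2)] by simp
    then have "grad bc us - hs = 0" using db' LIMSEQ_unique by blast
    then show "hs = grad bc us" by simp
    have "(\<lambda>k. b (Suc (r k))) \<longlonglongrightarrow> - (l1_norm (grad bc us) / (\<rho> * norm hs ^ 3)) *\<^sub>R hs"
      unfolding admm_stationary[OF admm \<open>\<rho> > 0\<close>]
      using hs \<open>\<rho> > 0\<close> by (intro tendsto_intros tendsto_l1_norm grad_lim lim) auto
    then show "bs = - (l1_norm (grad bc us) / (\<rho> * norm hs ^ 3)) *\<^sub>R hs"
      using lim(3) LIMSEQ_unique by blast
    fix v
    have "L_uncon bc lam A f \<rho> (u (Suc (r k))) (h (r k)) (b (r k))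
        \<le> L_uncon bc lam A f \<rho> v (h (r k)) (b (r k))" for k
      using admm by (auto simp: admm_sequence_def is_arg_min_linorder)
    then show "L_uncon bc lam A f \<rho> us hs bs \<le> L_uncon bc lam A f \<rho> v hs bs"
      by (intro LIMSEQ_le[OF tendsto_L_uncon[OF \<open>linear A\<close> lim(1) h_old b_old hs]
            tendsto_L_uncon[OF \<open>linear A\<close> tendsto_const h_old b_old hs]]) auto
  qed fact+
qed

theorem theorem4p5:
  fixes bc :: boundary
    and lam M \<epsilon> :: real
    and A :: "('m::{finite,linorder}, 'n::{finite,linorder}) img \<Rightarrow> 'd::euclidean_space"
  assumes "lam > 0"
    and "linear A"
    and A1: "{u. grad bc u = 0} \<inter> {u. A u = 0} = {0}"
    and "M \<ge> 0"
    and "\<epsilon> > 0"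
  shows "\<exists>\<rho>bar>0. \<forall>f. \<forall>\<rho>\<ge>\<rho>bar. \<forall>u h b.
           admm_sequence bc lam A f \<rho> u h b \<longrightarrow>
           bounded (range u) \<longrightarrow> M = (SUP k. l1_norm (grad bc (u k))) \<longrightarrow>
           (\<forall>k. norm (h k) \<ge> \<epsilon>) \<longrightarrow>
           (\<exists>r us hs. strict_mono r \<and>
                      (\<lambda>k. (u (r k), h (r k))) \<longlonglongrightarrow> (us, hs) \<and>
                      critical_point bc lam A f \<rho> us hs)"
proof -
  define a x where "a = 2 * real CARD('m) * real CARD('n) / \<epsilon>\<^sup>2" and "x = M / \<epsilon> ^ 3"
  have ax: "a \<ge> 0" "x \<ge> 0" using \<open>M \<ge> 0\<close> \<open>\<epsilon> > 0\<close> by (simp_all add: a_def x_def)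
  show ?thesis
  proof (intro exI[of _ "1 + 4 * a + 16 * x"] conjI allI impI)
    show "0 < 1 + 4 * a + 16 * x" using ax by linarith
    fix f :: 'd and \<rho> :: real and u :: "nat \<Rightarrow> ('m, 'n) img" and h b :: "nat \<Rightarrow> ('m, 'n) field2"
    assume rho: "1 + 4 * a + 16 * x \<le> \<rho>" and admm: "admm_sequence bc lam A f \<rho> u h b"
      and u_bounded: "bounded (range u)" and M: "M = (SUP k. l1_norm (grad bc (u k)))"
      and norms: "\<forall>k. \<epsilon> \<le> norm (h k)"
    have rho': "\<rho> > 0" "\<rho> \<ge> 4 * a" "\<rho> \<ge> 16 * x" using rho ax by linarith+
    have l1: "l1_norm (grad bc (u k)) \<le> M" for k
      unfolding M by (intro cSUP_upper bdd_above_l1_norm_grad u_bounded) simp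
    note incr = admm_increments_vanish[OF \<open>lam > 0\<close> \<open>linear A\<close> \<open>\<epsilon> > 0\<close> \<open>M \<ge> 0\<close>
        rho'(1) rho'(2)[unfolded a_def] rho'(3)[unfolded x_def] admm l1 norms[rule_format]]
    have "norm (b (Suc k)) \<le> M / (\<rho> * \<epsilon>\<^sup>2)" for k
      by (rule admm_multiplier_bound[OF admm rho'(1) \<open>\<epsilon> > 0\<close> l1 norms[rule_format]])
    then have b_bounded: "bounded (range (\<lambda>k. b (Suc k)))"
      by (auto simp: bounded_iff)
    have u1: "bounded (range (\<lambda>k. u (Suc k)))"
      by (rule bounded_subset[OF u_bounded]) auto
    \<comment> \<open>The multiplier update expresses \<open>h (Suc k)\<close> through bounded quantities.\<close>
    have "bounded (range (\<lambda>k. b (Suc k) - b k))"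
      using incr(2) convergent_imp_bounded by blast
    moreover have "bounded (range (\<lambda>k. grad bc (u (Suc k))))"
      using bounded_linear_image[OF u1 bounded_linear_grad[of bc]] by (simp add: image_image)
    ultimately have "bounded (range (\<lambda>k. grad bc (u (Suc k)) - (b (Suc k) - b k)))"
      by (rule bounded_minus_comp[rotated])
    moreover have "grad bc (u (Suc k)) - (b (Suc k) - b k) = h (Suc k)" for k
      using admm by (auto simp: admm_sequence_def)
    ultimately have h_bounded: "bounded (range (\<lambda>k. h (Suc k)))" by simp
    have "bounded (range (\<lambda>k. (u (Suc k), h (Suc k), b (Suc k))))"
      by (rule bounded_subset[OF bounded_Times[OF u1 bounded_Times[OF h_bounded b_bounded]]]) auto
    then obtain l r where r: "strict_mono r"
      and "((\<lambda>k. (u (Suc k), h (Suc k), b (Suc k))) \<circ> r) \<longlonglongrightarrow> l"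
      using bounded_imp_convergent_subsequence by blast
    moreover obtain us hs bs where "l = (us, hs, bs)" by (rule prod_cases3)
    ultimately have lim3: "(\<lambda>k. (u (Suc (r k)), h (Suc (r k)), b (Suc (r k)))) \<longlonglongrightarrow> (us, hs, bs)"
      by (simp add: o_def)
    have lim: "(\<lambda>k. u (Suc (r k))) \<longlonglongrightarrow> us" "(\<lambda>k. h (Suc (r k))) \<longlonglongrightarrow> hs" "(\<lambda>k. b (Suc (r k))) \<longlonglongrightarrow> bs"
      using tendsto_fst[OF lim3] tendsto_fst[OF tendsto_snd[OF lim3]] tendsto_snd[OF tendsto_snd[OF lim3]]
      by simp_all
    have "critical_point bc lam A f \<rho> us hs"
      by (rule admm_limit_critical[OF \<open>linear A\<close> rho'(1) \<open>\<epsilon> > 0\<close> admm norms[rule_format] incr r lim])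
    moreover have "strict_mono (\<lambda>k. Suc (r k))"
      using r by (simp add: strict_mono_def)
    ultimately show "\<exists>r us hs. strict_mono r \<and> (\<lambda>k. (u (r k), h (r k))) \<longlonglongrightarrow> (us, hs) \<and>
        critical_point bc lam A f \<rho> us hs"
      using tendsto_Pair[OF lim(1,2)] by blast
  qed
qed

end
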